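(* Let $G$ be a compact monothetic group with generator $\gamma_0$ such that $\hat G$ has no non-trivial element of finite order. Then for every continuous character $\chi$ on $G$ and for each $k\in\mathbb{N}$ the function $f:\mathbb{Z}\to\mathbb{C}$, $f(n)=\chi(n^k\gamma_0)$, is uniquely ergodic. In particular, for each $m\in\mathbb{Z}$, each $k\in\mathbb{N}$ and each irrational element $\lambda$ of $\mathbb{T}$, the function $f(n)=\lambda^{mn^k}$ on $\mathbb{Z}$ is uniquely ergodic.
   Context: A compact monothetic group with generator $\gamma_0$ is a compact Hausdorff topological group $G$ such that the subgroup generated by $\gamma_0\in G$ is dense in $G$ (so $G$ is abelian; it is written additively). $\hat G$ is the dual (character) group of $G$. $\mathbb{T}$ is the unit circle; $\lambda\in\mathbb{T}$ is irrational if it is not a root of unity. Let $V:l^\infty(\mathbb{Z})\to l^\infty(\mathbb{Z})$ be the shift $V(g)(n)=g(n+1)$. For $f\in l^\infty(\mathbb{Z})$, $X_f$ is the closure of $\{V^n(f):n\in\mathbb{Z}\}$ in $l^\infty(\mathbb{Z})$ in the topology of pointwise convergence on $\mathbb{Z}$; it is compact and $V$ restricts to a homeomorphism of $X_f$. The function $f$ is called uniquely ergodic if the dynamical system $(X_f,V)$ is uniquely ergodic, i.e. there is a unique $V$-invariant (regular Borel) probability measure on $X_f$. *)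

theory Defs
  imports "HOL-Probability.Probability" "HOL-Algebra.Group"
begin

(* Integer multiples in an additively written group; commutativity is not assumed. *)
definition int_mult :: "int \<Rightarrow> 'a::group_add \<Rightarrow> 'a" where
  "int_mult n x = (if 0 \<le> n then (((+) x) ^^ nat n) 0 else - ((((+) x) ^^ nat (- n)) 0))"

(* The compact Hausdorff group is the whole type; it is not assumed abelian, since this
   follows from the density of the cyclic subgroup. *)
definition compact_monothetic :: "'a::{topological_group_add,t2_space} \<Rightarrow> bool" where
  "compact_monothetic \<gamma> \<longleftrightarrow> compact (UNIV :: 'a set) \<and> closure (range (\<lambda>n. int_mult n \<gamma>)) = UNIV"

definition is_character :: "('a::topological_group_add \<Rightarrow> complex) \<Rightarrow> bool" where
  "is_character \<phi> \<longleftrightarrow>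
     continuous_on UNIV \<phi> \<and> (\<forall>x. \<phi> x \<in> sphere 0 1) \<and> (\<forall>x y. \<phi> (x + y) = \<phi> x * \<phi> y)"

definition dual_group :: "('a::topological_group_add \<Rightarrow> complex) monoid" where
  "dual_group = \<lparr>carrier = {\<phi>. is_character \<phi>}, mult = (\<lambda>\<phi> \<psi> x. \<phi> x * \<psi> x), one = (\<lambda>_. 1)\<rparr>"

lemma comm_group_dual_group: "comm_group (dual_group :: ('a::topological_group_add \<Rightarrow> complex) monoid)"
proof (rule comm_groupI)
  fix \<phi> :: "'a \<Rightarrow> complex"
  assume "\<phi> \<in> carrier dual_group"
  then have c: "continuous_on UNIV \<phi>" and n: "\<And>x. norm (\<phi> x) = 1"
    and h: "\<And>x y. \<phi> (x + y) = \<phi> x * \<phi> y"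
    by (auto simp: dual_group_def is_character_def)
  have nz: "\<phi> x \<noteq> 0" for x
    using n[of x] by auto
  have "is_character (\<lambda>x. inverse (\<phi> x))"
    unfolding is_character_def using c n h nz by (auto intro!: continuous_intros simp: norm_inverse)
  moreover have "(\<lambda>x. inverse (\<phi> x) * \<phi> x) = (\<lambda>_. 1)"
    using nz by auto
  ultimately show "\<exists>\<psi>\<in>carrier dual_group. \<psi> \<otimes>\<^bsub>dual_group\<^esub> \<phi> = \<one>\<^bsub>dual_group\<^esub>"
    by (intro bexI[of _ "\<lambda>x. inverse (\<phi> x)"]) (auto simp: dual_group_def)
qed (auto simp: dual_group_def is_character_def norm_mult mult_ac intro!: continuous_intros)

definition torsion_free :: "('a, 'b) monoid_scheme \<Rightarrow> bool" where
  "torsion_free H \<longleftrightarrow>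
     (\<forall>x\<in>carrier H. (\<exists>n::nat. 0 < n \<and> x [^]\<^bsub>H\<^esub> n = \<one>\<^bsub>H\<^esub>) \<longrightarrow> x = \<one>\<^bsub>H\<^esub>)"

definition irrational_circle :: "complex \<Rightarrow> bool" where
  "irrational_circle z \<longleftrightarrow> z \<in> sphere 0 1 \<and> \<not> (\<exists>n::nat. 0 < n \<and> z ^ n = 1)"

definition l_infty :: "(int \<Rightarrow> complex) set" where
  "l_infty = {g. bounded (range g)}"

definition shift :: "(int \<Rightarrow> complex) \<Rightarrow> (int \<Rightarrow> complex)" where
  "shift g = (\<lambda>n. g (n + 1))"

(* Meaningful for bijective T. *)
definition int_iter :: "('a \<Rightarrow> 'a) \<Rightarrow> int \<Rightarrow> 'a \<Rightarrow> 'a" where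
  "int_iter T n = (if 0 \<le> n then T ^^ nat n else inv_into UNIV T ^^ nat (- n))"

lemma int_iter_shift: "int_iter shift n g = (\<lambda>m. g (m + n))"
proof -
  have "inv_into UNIV shift h = (\<lambda>m. h (m - 1))" for h
    by (rule inv_f_eq) (auto simp: shift_def inj_def fun_eq_iff, metis diff_add_cancel)
  then have neg: "(inv_into UNIV shift ^^ k) g = (\<lambda>m. g (m - int k))" for k
    by (induction k) (auto simp: algebra_simps)
  have "(shift ^^ k) g = (\<lambda>m. g (m + int k))" for k
    by (induction k) (auto simp: shift_def algebra_simps)
  with neg show ?thesis
    by (auto simp: int_iter_def)
qed

(* The topology of the function type is the product topology, i.e. pointwise convergence. *)
definition orbit_closure :: "(int \<Rightarrow> complex) \<Rightarrow> (int \<Rightarrow> complex) set" where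
  "orbit_closure f = top_of_set l_infty closure_of (range (\<lambda>n. int_iter shift n f))"

definition regular_borel_measure_on :: "'a::t2_space set \<Rightarrow> 'a measure \<Rightarrow> bool" where
  "regular_borel_measure_on X M \<longleftrightarrow>
     sets M = sets (restrict_space borel X) \<and>
     (\<forall>B\<in>sets M. emeasure M B = (SUP K\<in>{K. K \<subseteq> B \<and> compact K}. emeasure M K)) \<and>
     (\<forall>B\<in>sets M. emeasure M B = (INF U\<in>{U. B \<subseteq> U \<and> openin (top_of_set X) U}. emeasure M U))"

definition invariant_probability_on :: "'a::t2_space set \<Rightarrow> ('a \<Rightarrow> 'a) \<Rightarrow> 'a measure \<Rightarrow> bool" where
  "invariant_probability_on X T M \<longleftrightarrow>
     regular_borel_measure_on X M \<and> prob_space M \<and>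
     (\<forall>B\<in>sets M. emeasure M (T -` B \<inter> X) = emeasure M B)"

(* Meant for a compact X and a map T that restricts to a homeomorphism of X. *)
definition uniquely_ergodic_system :: "'a::t2_space set \<Rightarrow> ('a \<Rightarrow> 'a) \<Rightarrow> bool" where
  "uniquely_ergodic_system X T \<longleftrightarrow> (\<exists>!M. invariant_probability_on X T M)"

definition uniquely_ergodic :: "(int \<Rightarrow> complex) \<Rightarrow> bool" where
  "uniquely_ergodic f \<longleftrightarrow> f \<in> l_infty \<and> uniquely_ergodic_system (orbit_closure f) shift"

end

theory Submission
  imports Defs
begin

text \<open>
  A character \<open>\<phi>\<close> satisfies \<open>\<phi> (n\<^sup>k \<gamma>\<^sub>0) = z powi (n ^ k)\<close> with \<open>z = \<phi> \<gamma>\<^sub>0\<close>. If \<open>z\<close> is a root of unity,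
  some power of \<open>\<phi>\<close> is trivial on the dense subgroup generated by \<open>\<gamma>\<^sub>0\<close>, hence everywhere, and then
  \<open>\<phi>\<close> is trivial because the dual is torsion free (\<open>character_trivial_or_irrational\<close>). So apart from
  constant functions everything reduces to \<open>f n = z powi (n ^ k)\<close> with \<open>z\<close> irrational, and \<open>m\<close> is
  absorbed by replacing \<open>z\<close> with \<open>z powi m\<close>.

  Unique ergodicity is read off from averages along the orbit of \<open>f\<close>. Call a finite product of
  coordinates \<open>x j\<close> and conjugate coordinates \<open>cnj (x j)\<close> a monomial on the space of sequences.
  Along the orbit of \<open>f\<close> a monomial takes the values \<open>z powi poly p n\<close> with an integer polynomial
  \<open>p\<close>. By Weyl's theorem (\<open>Weyl_uniform_mean\<close>, proved by van der Corput differencing) the averages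
  of such a sequence over windows of length \<open>N\<close> tend to \<open>0\<close>, uniformly in the position of the
  window, unless \<open>p\<close> is constant. Uniformity transfers the convergence from the orbit to its
  closure, so every invariant probability measure has to integrate each monomial to the limit of
  its averages; by the Stone--Weierstrass theorem this determines the measure.

  For existence a candidate is written down: the image of the Haar measure on a \<open>k\<close>-dimensional
  torus under \<open>y \<mapsto> (n \<mapsto> z powi (n ^ k) * (\<Prod>i<k. y i powi (n ^ i)))\<close>. Its integrals of monomials are
  computed directly, and they agree with the limits of the averages. This agreement alone forces
  the candidate to live on the orbit closure (\<open>orbit_mean_measure_on_orbit_closure\<close>) and to be
  invariant. The criterion \<open>uniquely_ergodic_if_uniform_means\<close> combines the two halves.
\<close>

section \<open>Uniform means and equidistribution of polynomial phases\<close>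

text \<open>
  The window \<open>{a..<a + N}\<close> may start anywhere, and the convergence is uniform in \<open>a\<close>. For the
  values of a continuous function along an orbit this is the same as uniform convergence of the
  ergodic averages on the orbit closure.
\<close>
definition has_uniform_mean :: "(int \<Rightarrow> complex) \<Rightarrow> complex \<Rightarrow> bool" where
  "has_uniform_mean u c \<longleftrightarrow>
     uniform_limit UNIV (\<lambda>N a. (\<Sum>n<N. u (a + int n)) / of_nat N) (\<lambda>a. c) sequentially"

lemma has_uniform_mean_unique:
  assumes "has_uniform_mean u c" "has_uniform_mean u d"
  shows "c = d"
proof -
  have "(\<lambda>N. (\<Sum>n<N. u (0 + int n)) / of_nat N) \<longlonglongrightarrow> b" if "has_uniform_mean u b" for b
    using tendsto_uniform_limitI[OF that[unfolded has_uniform_mean_def], of 0] by simp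
  then show ?thesis
    using assms LIMSEQ_unique by blast
qed

lemma has_uniform_mean_const: "has_uniform_mean (\<lambda>_. c) c"
  unfolding has_uniform_mean_def uniform_limit_sequentially_iff
  by (intro allI impI exI[of _ 1]) auto

lemma has_uniform_mean_add:
  assumes "has_uniform_mean u c" "has_uniform_mean v d"
  shows "has_uniform_mean (\<lambda>n. u n + v n) (c + d)"
  using uniform_limit_add[OF assms[unfolded has_uniform_mean_def]]
  by (simp add: has_uniform_mean_def sum.distrib add_divide_distrib)

lemma has_uniform_mean_cmult:
  assumes "has_uniform_mean u c"
  shows "has_uniform_mean (\<lambda>n. k * u n) (k * c)"
  using bounded_linear.uniform_limit[OF bounded_linear_mult_right assms[unfolded has_uniform_mean_def], of k]
  by (simp add: has_uniform_mean_def sum_distrib_left mult.assoc)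

lemma has_uniform_mean_sum:
  assumes "\<And>i. i \<in> I \<Longrightarrow> has_uniform_mean (u i) (c i)"
  shows "has_uniform_mean (\<lambda>n. \<Sum>i\<in>I. u i n) (\<Sum>i\<in>I. c i)"
  using assms
  by (induction I rule: infinite_finite_induct)
    (auto intro: has_uniform_mean_const has_uniform_mean_add)

lemma has_uniform_mean_zero_iff:
  "has_uniform_mean u 0 \<longleftrightarrow> (\<forall>e>0. \<exists>N0. \<forall>N\<ge>N0. \<forall>a. norm (\<Sum>n<N. u (a + int n)) \<le> e * real N)"
proof
  assume L: "has_uniform_mean u 0"
  show "\<forall>e>0. \<exists>N0. \<forall>N\<ge>N0. \<forall>a. norm (\<Sum>n<N. u (a + int n)) \<le> e * real N"
  proof (intro allI impI)
    fix e :: real assume "e > 0"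
    then obtain N0 where N0: "\<And>N a. N \<ge> N0 \<Longrightarrow> norm ((\<Sum>n<N. u (a + int n)) / of_nat N) < e"
      using L unfolding has_uniform_mean_def uniform_limit_sequentially_iff dist_norm diff_0_right by blast
    have "norm (\<Sum>n<N. u (a + int n)) \<le> e * real N" if "N \<ge> N0" for N a
      using N0[OF that, of a] by (cases "N = 0") (auto simp: norm_divide field_simps)
    then show "\<exists>N0. \<forall>N\<ge>N0. \<forall>a. norm (\<Sum>n<N. u (a + int n)) \<le> e * real N"
      by blast
  qed
next
  assume R: "\<forall>e>0. \<exists>N0. \<forall>N\<ge>N0. \<forall>a. norm (\<Sum>n<N. u (a + int n)) \<le> e * real N"
  show "has_uniform_mean u 0"
    unfolding has_uniform_mean_def uniform_limit_sequentially_iff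
  proof (intro allI impI)
    fix e :: real assume e: "e > 0"
    then obtain N0 where N0: "\<And>N a. N \<ge> N0 \<Longrightarrow> norm (\<Sum>n<N. u (a + int n)) \<le> e / 2 * real N"
      using R[rule_format, of "e/2"] by auto
    have "dist ((\<Sum>n<N. u (a + int n)) / of_nat N) 0 < e" if "N \<ge> N0" for N a
    proof (cases "N = 0")
      case False
      have "norm (\<Sum>n<N. u (a + int n)) < e * real N"
        using N0[OF that, of a] e False by (intro le_less_trans[OF N0[OF that, of a]]) auto
      then show ?thesis
        using False by (simp add: norm_divide field_simps)
    qed (use e in auto)
    then show "\<exists>N0. \<forall>N\<ge>N0. \<forall>a\<in>UNIV. dist ((\<Sum>n<N. u (a + int n)) / of_nat N) 0 < e"
      by blast
  qed
qed

text \<open>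
  Moving a window by \<open>h\<close> changes at most \<open>2 * h\<close> of the summands.
\<close>
lemma window_shift_bound:
  fixes u :: "int \<Rightarrow> complex"
  assumes "\<And>n. norm (u n) \<le> B"
  shows "norm ((\<Sum>n<N. u (a + int n + int h)) - (\<Sum>n<N. u (a + int n))) \<le> 2 * B * real h"
proof (induction h)
  case (Suc h)
  define v where "v = (\<lambda>n. u (a + int n + int h))"
  have "(\<Sum>n<N. u (a + int n + int (Suc h))) = (\<Sum>n<N. v (Suc n))"
    by (simp add: v_def algebra_simps)
  also have "\<dots> = (\<Sum>n<N. v n) + (v N - v 0)"
    by (induction N) auto
  finally have "(\<Sum>n<N. u (a + int n + int (Suc h))) - (\<Sum>n<N. u (a + int n)) =
     ((\<Sum>n<N. u (a + int n + int h)) - (\<Sum>n<N. u (a + int n))) + (v N - v 0)"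
    by (simp add: v_def)
  also have "norm \<dots> \<le> 2 * B * real h + (norm (v N) + norm (v 0))"
    using Suc.IH by (intro norm_triangle_mono norm_triangle_ineq4)
  also have "\<dots> \<le> 2 * B * real h + (B + B)"
    by (intro add_mono order_refl) (auto simp: v_def assms)
  finally show ?case
    by (simp add: algebra_simps)
qed auto

lemma has_uniform_mean_shift:
  assumes mean: "has_uniform_mean u c" and bdd: "\<And>n. norm (u n) \<le> B"
  shows "has_uniform_mean (\<lambda>n. u (n + 1)) c"
proof -
  have "has_uniform_mean (\<lambda>n. u (n + 1) - u n) 0"
    unfolding has_uniform_mean_zero_iff
  proof (intro allI impI)
    fix e :: real assume "e > 0"
    have "norm (\<Sum>n<N. u (a + int n + 1) - u (a + int n)) \<le> e * real N" if N: "N \<ge> nat \<lceil>2 * B / e\<rceil>" for N a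
    proof -
      have "2 * B \<le> e * real N"
        using N \<open>e > 0\<close> by (simp add: field_simps nat_le_iff ceiling_le_iff)
      then show ?thesis
        using window_shift_bound[of u B a 1 N] bdd by (simp add: sum_subtractf)
    qed
    then show "\<exists>N0. \<forall>N\<ge>N0. \<forall>a. norm (\<Sum>n<N. u (a + int n + 1) - u (a + int n)) \<le> e * real N"
      by blast
  qed
  from has_uniform_mean_add[OF mean this] show ?thesis
    by simp
qed

text \<open>
  Up to an error that is bounded independently of the window, averaging \<open>u\<close> is the same as
  averaging \<open>v n / H\<close> with \<open>v n = (\<Sum>h<H. u (n + h))\<close>. By the Cauchy--Schwarz inequality the latter
  average is controlled by the mean of \<open>(norm (v n))\<^sup>2\<close>. In its expansion the off-diagonal terms are
  correlations of \<open>u\<close> and have mean \<open>0\<close>, while the diagonal contributes only \<open>H\<close>. The bound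
  obtained in this way is of order \<open>1 / sqrt H\<close>, and \<open>H\<close> is arbitrary.
\<close>
lemma van_der_Corput_uniform_mean:
  assumes unit: "\<And>n. norm (u n) = 1"
    and corr: "\<And>h h' :: nat. h \<noteq> h' \<Longrightarrow> has_uniform_mean (\<lambda>n. u (n + int h) * cnj (u (n + int h'))) 0"
  shows "has_uniform_mean u 0"
  unfolding has_uniform_mean_zero_iff
proof (intro allI impI)
  fix e :: real assume e: "e > 0"
  \<comment> \<open>The final bound is \<open>sqrt (2 / H) + 2 * H / N\<close>; this \<open>H\<close> makes the first part at most \<open>e / 2\<close>,
  and \<open>N \<ge> 4 * H / e\<close> then does the same for the second.\<close>
  define H where "H = Suc (nat \<lceil>8 / e\<^sup>2\<rceil>)"
  have H0: "real H > 0"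
    unfolding H_def of_nat_0_less_iff by (rule zero_less_Suc)
  have H: "8 / e\<^sup>2 \<le> real H"
    unfolding H_def of_nat_Suc using real_nat_ceiling_ge[of "8 / e\<^sup>2"] by linarith
  define v where "v = (\<lambda>n. \<Sum>h<H. u (n + int h))"
  have diag: "u n * cnj (u n) = 1" for n
    using unit[of n] by (simp add: complex_norm_square[symmetric])
  have "has_uniform_mean (\<lambda>n. \<Sum>h<H. \<Sum>h'<H. u (n + int h) * cnj (u (n + int h')))
          (\<Sum>h<H. \<Sum>h'<H. if h = h' then 1 else 0)"
  proof (intro has_uniform_mean_sum)
    fix h h' :: nat
    show "has_uniform_mean (\<lambda>n. u (n + int h) * cnj (u (n + int h'))) (if h = h' then 1 else 0)"
      using corr[of h h'] by (auto simp: diag has_uniform_mean_const)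
  qed
  also have "(\<lambda>n. \<Sum>h<H. \<Sum>h'<H. u (n + int h) * cnj (u (n + int h'))) = (\<lambda>n. of_real ((norm (v n))\<^sup>2))"
    by (simp only: complex_norm_square) (simp add: v_def sum_product)
  also have "(\<Sum>h<H. \<Sum>h'<H. if h = h' then 1 else 0) = (of_nat H :: complex)"
    by simp
  finally have energy: "has_uniform_mean (\<lambda>n. of_real ((norm (v n))\<^sup>2)) (of_nat H)" .
  have "has_uniform_mean (\<lambda>n. of_real ((norm (v n))\<^sup>2) + - of_nat H) (of_nat H + - of_nat H)"
    by (intro has_uniform_mean_add energy has_uniform_mean_const)
  then have "has_uniform_mean (\<lambda>n. of_real ((norm (v n))\<^sup>2) - of_nat H) 0"
    by simp
  then obtain N1 where N1: "\<And>N a. N \<ge> N1 \<Longrightarrow>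
      norm (\<Sum>n<N. complex_of_real ((norm (v (a + int n)))\<^sup>2) - of_nat H) \<le> real H * real N"
    unfolding has_uniform_mean_zero_iff using H0 by blast
  define N0 where "N0 = max N1 (nat \<lceil>4 * real H / e\<rceil>)"
  have "norm (\<Sum>n<N. u (a + int n)) \<le> e * real N" if N: "N \<ge> N0" for N a
  proof -
    let ?S = "\<Sum>n<N. u (a + int n)"
    have "(\<Sum>n<N. (norm (v (a + int n)))\<^sup>2) - real H * real N
            = Re (\<Sum>n<N. complex_of_real ((norm (v (a + int n)))\<^sup>2) - of_nat H)"
      by (simp add: sum_subtractf)
    also have "\<dots> \<le> real H * real N"
      using N1[of N a] N complex_Re_le_cmod order_trans unfolding N0_def by (metis max.bounded_iff)
    finally have en: "(\<Sum>n<N. (norm (v (a + int n)))\<^sup>2) \<le> 2 * real H * real N"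
      by simp
    have "(norm (\<Sum>n<N. v (a + int n)))\<^sup>2 \<le> (\<Sum>n<N. norm (v (a + int n)) * 1)\<^sup>2"
      by (intro power_mono) (auto intro: norm_sum)
    also have "\<dots> \<le> (\<Sum>n<N. (norm (v (a + int n)))\<^sup>2) * (\<Sum>n<N. 1\<^sup>2)"
      by (rule Cauchy_Schwarz_ineq_sum)
    also have "\<dots> \<le> 2 * real H * real N * real N"
      using en by (simp add: mult_right_mono)
    also have "\<dots> \<le> (e / 2 * real H * real N)\<^sup>2"
    proof -
      have "8 \<le> real H * e\<^sup>2"
        using H e by (simp add: field_simps)
      then have "8 * (real H * (real N)\<^sup>2) \<le> real H * e\<^sup>2 * (real H * (real N)\<^sup>2)"
        by (rule mult_right_mono) auto
      then show ?thesis
        by (simp add: power2_eq_square field_simps)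
    qed
    finally have vbound: "norm (\<Sum>n<N. v (a + int n)) \<le> e / 2 * real H * real N"
      using e H0 by (meson abs_le_square_iff norm_ge_zero power2_le_imp_le mult_nonneg_nonneg of_nat_0_le_iff less_imp_le half_gt_zero)
    have "norm (of_nat H * ?S) = norm ((\<Sum>n<N. v (a + int n)) -
             (\<Sum>h<H. (\<Sum>n<N. u (a + int n + int h)) - ?S))"
      unfolding v_def by (subst sum.swap) (simp add: sum_subtractf)
    also have "\<dots> \<le> norm (\<Sum>n<N. v (a + int n)) + (\<Sum>h<H. norm ((\<Sum>n<N. u (a + int n + int h)) - ?S))"
      by (rule order_trans[OF norm_triangle_ineq4 add_left_mono[OF norm_sum]])
    also have "\<dots> \<le> e / 2 * real H * real N + (\<Sum>h<H. 2 * 1 * real H)"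
    proof (intro add_mono vbound sum_mono)
      fix h assume "h \<in> {..<H}"
      then show "norm ((\<Sum>n<N. u (a + int n + int h)) - ?S) \<le> 2 * 1 * real H"
        by (intro order_trans[OF window_shift_bound[of u 1]]) (auto simp: unit)
    qed
    finally have "real H * norm ?S \<le> real H * (e / 2 * real N + 2 * real H)"
      by (simp add: norm_mult algebra_simps)
    then have "norm ?S \<le> e / 2 * real N + 2 * real H"
      using H0 by simp
    moreover have "4 * real H \<le> e * real N"
      using N e by (simp add: N0_def field_simps nat_le_iff ceiling_le_iff)
    ultimately show ?thesis
      by simp
  qed
  then show "\<exists>N0. \<forall>N\<ge>N0. \<forall>a. norm (\<Sum>n<N. u (a + int n)) \<le> e * real N"
    by blast
qed

text \<open>
  Multiplying a window sum by \<open>w - 1\<close> makes it telescope, so the window sums are bounded.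
\<close>
lemma geometric_uniform_mean:
  assumes unit: "\<And>n. norm (u n) = 1" and step: "\<And>n. u (n + 1) = w * u n" and "w \<noteq> 1"
  shows "has_uniform_mean u 0"
  unfolding has_uniform_mean_zero_iff
proof (intro allI impI)
  fix e :: real assume e: "e > 0"
  have w: "norm (w - 1) > 0"
    using \<open>w \<noteq> 1\<close> by simp
  have "norm (\<Sum>n<N. u (a + int n)) \<le> e * real N" if N: "N \<ge> nat \<lceil>2 / norm (w - 1) / e\<rceil>" for N a
  proof -
    have "norm (w - 1) * norm (\<Sum>n<N. u (a + int n))
            = norm ((\<Sum>n<N. u (a + int n + int 1)) - (\<Sum>n<N. u (a + int n)))"
      by (simp add: step norm_mult[symmetric] left_diff_distrib sum_distrib_left sum_subtractf)
    also have "\<dots> \<le> 2"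
      using window_shift_bound[of u 1 a 1 N] unit by simp
    finally have "norm (\<Sum>n<N. u (a + int n)) \<le> 2 / norm (w - 1)"
      using w by (simp add: field_simps)
    also have "\<dots> \<le> e * real N"
      using N e w by (simp add: nat_le_iff ceiling_le_iff field_simps)
    finally show ?thesis .
  qed
  then show "\<exists>N0. \<forall>N\<ge>N0. \<forall>a. norm (\<Sum>n<N. u (a + int n)) \<le> e * real N"
    by blast
qed

lemma coeff_pcompose_translate:
  fixes p :: "'a::comm_ring_1 poly"
  shows "coeff (pcompose p [:h, 1:]) j = (\<Sum>i\<le>degree p. coeff p i * (of_nat (i choose j) * h ^ (i - j)))"
proof -
  have "pcompose p [:h, 1:] = (\<Sum>i\<le>degree p. smult (coeff p i) ([:h, 1:] ^ i))"
    unfolding pcompose_altdef poly_altdef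
    by (auto simp: degree_map_poly coeff_map_poly intro!: sum.cong)
  moreover have "coeff ([:h, 1:] ^ i) j = of_nat (i choose j) * h ^ (i - j)" for i
  proof (cases "j \<le> i")
    case False
    have "degree ([:h, 1:] ^ i) \<le> i"
      using degree_power_le[of "[:h, 1:]" i] by (auto split: if_splits)
    then show ?thesis
      using False by (simp add: coeff_eq_0 binomial_eq_0)
  qed (simp add: coeff_linear_poly_power)
  ultimately show ?thesis
    by (simp add: coeff_sum)
qed

text \<open>
  Differencing lowers the degree by exactly one: the two leading coefficients cancel, and the next
  coefficient becomes \<open>(d + 1) * lead_coeff p * (h - h')\<close>.
\<close>
lemma degree_translate_diff:
  fixes p :: "int poly"
  assumes deg: "degree p = Suc d" and "h \<noteq> h'"
  defines "q \<equiv> pcompose p [:h, 1:] - pcompose p [:h', 1:]"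
  shows "degree q = d" and "coeff q d \<noteq> 0"
proof -
  have co: "coeff q j = (\<Sum>i\<le>Suc d. coeff p i * (of_nat (i choose j) * (h ^ (i - j) - h' ^ (i - j))))" for j
    by (simp only: q_def coeff_diff coeff_pcompose_translate deg sum_subtractf[symmetric] right_diff_distrib)
  have zero: "(i choose j) * (h ^ (i - j) - h' ^ (i - j)) = 0" if "i \<le> j" for i j
    using that by (cases "i = j") (auto simp: binomial_eq_0)
  have "coeff q j = 0" if "j > d" for j
    unfolding co using that zero by (intro sum.neutral) auto
  then have le: "degree q \<le> d"
    by (intro degree_le) auto
  have "coeff q d = (\<Sum>i\<in>{Suc d}. coeff p i * (of_nat (i choose d) * (h ^ (i - d) - h' ^ (i - d))))"
    unfolding co using zero by (intro sum.mono_neutral_right) auto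
  then have "coeff q d = coeff p (Suc d) * (int (Suc d) * (h - h'))"
    by simp
  moreover have "coeff p (Suc d) \<noteq> 0"
    using deg by (metis degree_0 leading_coeff_0_iff nat.distinct(1))
  ultimately show nz: "coeff q d \<noteq> 0"
    using \<open>h \<noteq> h'\<close> by simp
  show "degree q = d"
    using le le_degree[OF nz] by simp
qed

lemma cnj_power_int_unit: "norm w = 1 \<Longrightarrow> cnj (w powi n) = w powi (- n)"
  using complex_norm_square[of "w powi n"]
  by (simp add: norm_power_int power_int_minus) (metis inverse_unique)

lemma irrational_circle_nonzero: "irrational_circle z \<Longrightarrow> z \<noteq> 0"
  by (auto simp: irrational_circle_def)

lemma norm_irrational_powi: "irrational_circle z \<Longrightarrow> norm (z powi n) = 1"
  by (simp add: irrational_circle_def norm_power_int)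

lemma irrational_circle_powi:
  assumes z: "irrational_circle z" and "m \<noteq> 0"
  shows "irrational_circle (z powi m)"
proof -
  have "(z powi m) ^ n \<noteq> 1" if n: "n > 0" for n :: nat
  proof
    assume A: "(z powi m) ^ n = 1"
    have "z powi (m * int n) = 1"
      using A by (simp add: power_int_mult)
    then have "z powi \<bar>m * int n\<bar> = 1"
      by (cases "m * int n \<ge> 0") (auto simp: power_int_minus)
    then have "z ^ nat \<bar>m * int n\<bar> = 1"
      by (simp add: power_int_def)
    moreover have "nat \<bar>m * int n\<bar> > 0"
      using n \<open>m \<noteq> 0\<close> by simp
    ultimately show False
      using z unfolding irrational_circle_def by blast
  qed
  then show ?thesis
    using norm_irrational_powi[OF z] by (auto simp: irrational_circle_def)
qed

text \<open>
  This is Weyl's argument: a correlation of \<open>z powi poly p n\<close> is a polynomial phase of one degree less, so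
  van der Corput's inequality reduces the claim to degree one, where the sequence is geometric with
  a ratio that differs from \<open>1\<close> because \<open>z\<close> is not a root of unity.
\<close>
lemma Weyl_uniform_mean:
  assumes z: "irrational_circle z" and deg: "degree p = Suc d"
  shows "has_uniform_mean (\<lambda>n. z powi poly p n) 0"
  using deg
proof (induction d arbitrary: p)
  case 0
  have z0: "z \<noteq> 0"
    using z by (rule irrational_circle_nonzero)
  have c: "coeff p 1 \<noteq> 0"
    using 0 by (metis One_nat_def degree_0 leading_coeff_0_iff nat.distinct(1))
  have p: "poly p n = coeff p 0 + n * coeff p 1" for n
    using 0 by (simp add: poly_altdef mult.commute)
  have "z powi coeff p 1 \<noteq> 1"
    using irrational_circle_powi[OF z c] unfolding irrational_circle_def
    by (metis power_one_right zero_less_one)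
  moreover have "z powi poly p (n + 1) = z powi coeff p 1 * z powi poly p n" for n
    using z0 by (simp add: p ring_distribs add.assoc[symmetric] power_int_add)
  ultimately show ?case
    by (intro geometric_uniform_mean[where w = "z powi coeff p 1"]) (auto simp: norm_irrational_powi z)
next
  case (Suc d)
  have z0: "z \<noteq> 0"
    using z by (rule irrational_circle_nonzero)
  have norm_z: "norm z = 1"
    using z by (simp add: irrational_circle_def)
  show ?case
  proof (rule van_der_Corput_uniform_mean)
    fix h h' :: nat assume "h \<noteq> h'"
    define q where "q = pcompose p [:int h, 1:] - pcompose p [:int h', 1:]"
    have "z powi poly p (n + int h) * cnj (z powi poly p (n + int h')) = z powi poly q n" for n
      unfolding cnj_power_int_unit[OF norm_z]
      using z0 by (simp add: q_def poly_pcompose add.commute power_int_diff power_int_minus divide_inverse)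
    moreover have "degree q = Suc d"
      unfolding q_def using Suc.prems \<open>h \<noteq> h'\<close> by (intro degree_translate_diff) auto
    ultimately show "has_uniform_mean (\<lambda>n. z powi poly p (n + int h) * cnj (z powi poly p (n + int h'))) 0"
      using Suc.IH by simp
  qed (simp add: norm_irrational_powi z)
qed

section \<open>Orbit closures and polynomials in the coordinates\<close>

text \<open>
  By Tychonoff's theorem these closed balls of the supremum norm are compact for pointwise
  convergence. The orbit closure of a bounded sequence lies in such a ball.
\<close>
definition sup_ball :: "real \<Rightarrow> (int \<Rightarrow> complex) set" where
  "sup_ball B = {g. \<forall>n. norm (g n) \<le> B}"

lemma compact_sup_ball: "compact (sup_ball B)"
proof -
  have "sup_ball B = PiE UNIV (\<lambda>_. cball 0 B)"
    by (auto simp: sup_ball_def PiE_def Pi_def)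
  moreover have "compactin (product_topology (\<lambda>_. euclidean) UNIV) (PiE (UNIV :: int set) (\<lambda>_. cball (0::complex) B))"
    by (simp add: compactin_PiE)
  ultimately show ?thesis
    by (simp add: euclidean_product_topology)
qed

lemma sup_ball_subset_l_infty: "sup_ball B \<subseteq> l_infty"
  by (auto simp: sup_ball_def l_infty_def bounded_iff)

lemma orbit_closure_eq:
  assumes "f \<in> sup_ball B"
  shows "orbit_closure f = closure (range (\<lambda>n m. f (m + n)))" (is "_ = closure ?O")
    and "orbit_closure f \<subseteq> sup_ball B"
proof -
  have O: "?O \<subseteq> sup_ball B"
    using assms by (auto simp: sup_ball_def)
  then have cl: "closure ?O \<subseteq> sup_ball B"
    by (intro closure_minimal compact_imp_closed compact_sup_ball)
  have "orbit_closure f = l_infty \<inter> closure ?O"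
    using O sup_ball_subset_l_infty[of B]
    by (simp add: orbit_closure_def int_iter_shift closure_of_subtopology Int_absorb1)
  with cl sup_ball_subset_l_infty[of B] show "orbit_closure f = closure ?O"
    by auto
  with cl show "orbit_closure f \<subseteq> sup_ball B"
    by simp
qed

lemma continuous_coordinate: "continuous_on S (\<lambda>x :: int \<Rightarrow> complex. x j)"
  by (rule continuous_on_product_coordinates[THEN continuous_on_subset]) auto

lemma continuous_shift: "continuous_on S shift"
  unfolding shift_def by (intro continuous_on_coordinatewise_then_product continuous_coordinate)

lemma funpow_shift: "(shift ^^ n) g = (\<lambda>m. g (m + int n))"
  by (induction n) (auto simp: shift_def algebra_simps)

lemma shift_orbit_closure_subset:
  assumes "f \<in> sup_ball B"
  shows "shift ` orbit_closure f \<subseteq> orbit_closure f"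
proof -
  let ?O = "range (\<lambda>n m. f (m + n))"
  have "shift (\<lambda>m. f (m + n)) = (\<lambda>m. f (m + (n + 1)))" for n
    by (simp add: shift_def ac_simps)
  then have "shift ` ?O \<subseteq> closure ?O"
    by (auto intro!: subsetD[OF closure_subset])
  then have "shift ` closure ?O \<subseteq> closure ?O"
    by (intro image_closure_subset continuous_shift closed_closure)
  then show ?thesis
    by (simp add: orbit_closure_eq(1)[OF assms])
qed

inductive_set coordinate_monomials :: "((int \<Rightarrow> complex) \<Rightarrow> complex) set" where
  one: "(\<lambda>_. 1) \<in> coordinate_monomials"
| coord: "F \<in> coordinate_monomials \<Longrightarrow> (\<lambda>x. x j * F x) \<in> coordinate_monomials"
| conj_coord: "F \<in> coordinate_monomials \<Longrightarrow> (\<lambda>x. cnj (x j) * F x) \<in> coordinate_monomials"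

lemma continuous_coordinate_monomial: "F \<in> coordinate_monomials \<Longrightarrow> continuous_on S F"
  by (induction rule: coordinate_monomials.induct)
    (auto intro!: continuous_intros continuous_coordinate)

lemma coordinate_monomial_mult:
  "F \<in> coordinate_monomials \<Longrightarrow> G \<in> coordinate_monomials \<Longrightarrow> (\<lambda>x. F x * G x) \<in> coordinate_monomials"
  by (induction rule: coordinate_monomials.induct)
    (auto simp: mult.assoc intro: coordinate_monomials.intros)

lemma coordinate_monomial_shift:
  "F \<in> coordinate_monomials \<Longrightarrow> (\<lambda>x. F (shift x)) \<in> coordinate_monomials"
  by (induction rule: coordinate_monomials.induct)
    (auto simp: shift_def intro: coordinate_monomials.intros)

inductive_set coordinate_polynomials :: "((int \<Rightarrow> complex) \<Rightarrow> complex) set" where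
  monomial: "F \<in> coordinate_monomials \<Longrightarrow> (\<lambda>x. c * F x) \<in> coordinate_polynomials"
| add: "F \<in> coordinate_polynomials \<Longrightarrow> G \<in> coordinate_polynomials \<Longrightarrow> (\<lambda>x. F x + G x) \<in> coordinate_polynomials"

lemma continuous_coordinate_polynomial: "F \<in> coordinate_polynomials \<Longrightarrow> continuous_on S F"
  by (induction rule: coordinate_polynomials.induct)
    (simp_all add: continuous_on_add continuous_on_mult_left continuous_coordinate_monomial)

lemma coordinate_polynomial_mult:
  assumes "F \<in> coordinate_polynomials" "G \<in> coordinate_polynomials"
  shows "(\<lambda>x. F x * G x) \<in> coordinate_polynomials"
  using assms(1)
proof (induction rule: coordinate_polynomials.induct)
  case (monomial F c)
  from assms(2) show ?case
  proof (induction rule: coordinate_polynomials.induct)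
    case (monomial G d)
    with \<open>F \<in> coordinate_monomials\<close> show ?case
      using coordinate_polynomials.monomial[OF coordinate_monomial_mult, of F G "c * d"]
      by (simp add: mult_ac)
  qed (auto simp: ring_distribs intro: coordinate_polynomials.add)
qed (auto simp: ring_distribs intro: coordinate_polynomials.add)

text \<open>
  The Stone--Weierstrass theorem, applied to the real-valued members of the algebra of coordinate
  polynomials. Because the algebra contains conjugate coordinates, it contains the real and
  imaginary parts of every coordinate, and these separate sequences.
\<close>
lemma coordinate_polynomials_dense:
  fixes \<psi> :: "(int \<Rightarrow> complex) \<Rightarrow> real"
  assumes K: "compact K" and \<psi>: "continuous_on K \<psi>" and e: "e > 0"
  obtains F where "F \<in> coordinate_polynomials" "\<And>x. x \<in> K \<Longrightarrow> norm (F x - of_real (\<psi> x)) < e"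
proof -
  let ?P = "\<lambda>h :: (int \<Rightarrow> complex) \<Rightarrow> real. (\<lambda>x. of_real (h x)) \<in> coordinate_polynomials"
  have coord: "(\<lambda>x. c * x j) \<in> coordinate_polynomials" "(\<lambda>x. c * cnj (x j)) \<in> coordinate_polynomials" for c j
    using coordinate_polynomials.monomial[OF coordinate_monomials.coord[OF coordinate_monomials.one], of c j]
      coordinate_polynomials.monomial[OF coordinate_monomials.conj_coord[OF coordinate_monomials.one], of c j]
    by simp_all
  have "\<exists>h. ?P h \<and> (\<forall>x\<in>K. \<bar>\<psi> x - h x\<bar> < e)"
  proof (rule Stone_Weierstrass_HOL[OF K _ _ _ _ _ \<psi> e])
    show "?P (\<lambda>_. c)" for c
      using coordinate_polynomials.monomial[OF coordinate_monomials.one, of "of_real c"] by simp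
    show "continuous_on K h" if "?P h" for h
      using continuous_on_Re[OF continuous_coordinate_polynomial[OF that]] by simp
    show "?P (\<lambda>x. h x + k x)" if "?P h \<and> ?P k" for h k
      using that coordinate_polynomials.add by simp
    show "?P (\<lambda>x. h x * k x)" if "?P h \<and> ?P k" for h k
      using that coordinate_polynomial_mult by simp
    show "\<exists>h. ?P h \<and> h x \<noteq> h y" if "x \<in> K \<and> y \<in> K \<and> x \<noteq> y" for x y
    proof -
      from that obtain j where j: "x j \<noteq> y j"
        by auto
      have "(\<lambda>x. (1/2) * x j + (1/2) * cnj (x j)) \<in> coordinate_polynomials"
        by (intro coordinate_polynomials.add coord)
      also have "(\<lambda>x. (1/2) * x j + (1/2) * cnj (x j)) = (\<lambda>x. of_real (Re (x j)))"
        by (auto simp: fun_eq_iff complex_eq_iff)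
      finally have re: "?P (\<lambda>x. Re (x j))" .
      have "(\<lambda>x. (- \<i>/2) * x j + (\<i>/2) * cnj (x j)) \<in> coordinate_polynomials"
        by (intro coordinate_polynomials.add coord)
      also have "(\<lambda>x. (- \<i>/2) * x j + (\<i>/2) * cnj (x j)) = (\<lambda>x. of_real (Im (x j)))"
        by (auto simp: fun_eq_iff complex_eq_iff)
      finally have im: "?P (\<lambda>x. Im (x j))" .
      from j have "Re (x j) \<noteq> Re (y j) \<or> Im (x j) \<noteq> Im (y j)"
        by (auto simp: complex_eq_iff)
      then show ?thesis
        using exI[of "\<lambda>h. ?P h \<and> h x \<noteq> h y", OF conjI[OF re]] exI[of "\<lambda>h. ?P h \<and> h x \<noteq> h y", OF conjI[OF im]]
        by blast
    qed
  qed
  then obtain h where h: "?P h" "\<And>x. x \<in> K \<Longrightarrow> \<bar>\<psi> x - h x\<bar> < e"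
    by blast
  show thesis
  proof (rule that[OF h(1)])
    show "norm (of_real (h x) - complex_of_real (\<psi> x)) < e" if "x \<in> K" for x
      using h(2)[OF that] by (simp add: of_real_diff[symmetric] abs_minus_commute del: of_real_diff)
  qed
qed

section \<open>Measures determined by their integrals over monomials\<close>

lemma integrable_continuous_on_compact_support:
  fixes F :: "'a::t2_space \<Rightarrow> 'b::{banach, second_countable_topology}"
  assumes "prob_space M" and M: "sets M = sets borel" and K: "compact K" and supp: "AE x in M. x \<in> K"
    and F: "continuous_on UNIV F"
  shows "integrable M F"
proof -
  interpret prob_space M by fact
  have "bounded (F ` K)"
    using K F by (intro compact_imp_bounded compact_continuous_image) (auto intro: continuous_on_subset)
  then obtain B where "\<And>x. x \<in> K \<Longrightarrow> norm (F x) \<le> B"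
    by (auto simp: bounded_iff)
  with supp have "AE x in M. norm (F x) \<le> B"
    by auto
  moreover have "F \<in> borel_measurable M"
    using F M by (simp add: borel_measurable_continuous_onI cong: measurable_cong_sets)
  ultimately show ?thesis
    by (rule integrable_const_bound)
qed

lemma integral_close_on_support:
  fixes F G :: "'a::t2_space \<Rightarrow> complex"
  assumes "prob_space M" and M: "sets M = sets borel" and K: "compact K" and supp: "AE x in M. x \<in> K"
    and F: "continuous_on UNIV F" and G: "continuous_on UNIV G"
    and close: "\<And>x. x \<in> K \<Longrightarrow> norm (F x - G x) \<le> e"
  shows "norm ((LINT x|M. F x) - (LINT x|M. G x)) \<le> e"
proof -
  interpret prob_space M by fact
  have int: "integrable M F" "integrable M G"
    by (rule integrable_continuous_on_compact_support[OF assms(1-4)]; fact)+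
  then have "norm ((LINT x|M. F x) - (LINT x|M. G x)) = norm (LINT x|M. F x - G x)"
    by simp
  also have "\<dots> \<le> (LINT x|M. norm (F x - G x))"
    by (rule integral_norm_bound)
  also have "\<dots> \<le> (LINT x|M. e)"
    using int supp close by (intro integral_mono_AE) auto
  finally show ?thesis
    by (simp add: prob_space)
qed

text \<open>
  The indicator of a closed set is a pointwise limit of continuous functions with values in
  \<open>[0, 1]\<close>, and the closed sets form an intersection-stable generator of the Borel sets.
\<close>
lemma measure_eqI_continuous_integrals:
  fixes M N :: "'a::metric_space measure"
  assumes M: "prob_space M" "sets M = sets borel" and N: "prob_space N" "sets N = sets borel"
    and eq: "\<And>h :: 'a \<Rightarrow> real. continuous_on UNIV h \<Longrightarrow> (\<And>x. 0 \<le> h x \<and> h x \<le> 1) \<Longrightarrow>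
               (LINT x|M. h x) = (LINT x|N. h x)"
  shows "M = N"
proof (rule measure_eqI_generator_eq)
  show "Int_stable (Collect closed :: 'a set set)"
    by (auto simp: Int_stable_def)
  show "sets M = sigma_sets UNIV (Collect closed)" "sets N = sigma_sets UNIV (Collect closed)"
    unfolding M N by (simp_all add: borel_eq_closed)
  show "Collect closed \<subseteq> Pow (UNIV :: 'a set)"
    by simp
  show "range (\<lambda>_::nat. UNIV) \<subseteq> (Collect closed :: 'a set set)" "(\<Union>i::nat. UNIV) = (UNIV :: 'a set)"
    by auto
  show "emeasure M UNIV \<noteq> \<infinity>" for i :: nat
    using finite_measure.emeasure_finite[OF prob_space.finite_measure[OF M(1)]] by simp
next
  fix C :: "'a set" assume "C \<in> Collect closed"
  then have C: "closed C" by simp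
  \<comment> \<open>Equal to \<open>1\<close> on \<open>C\<close> and to \<open>0\<close> beyond distance \<open>1 / n\<close> from \<open>C\<close>.\<close>
  define h where "h = (\<lambda>n::nat. \<lambda>x. max 0 (1 - real n * infdist x C))"
  have h: "continuous_on UNIV (h n)" "0 \<le> h n x" "h n x \<le> 1" for n x
    by (auto simp: h_def infdist_nonneg intro!: continuous_intros)
  show "emeasure M C = emeasure N C"
  proof (cases "C = {}")
    case False
    have lim: "(\<lambda>n. h n x) \<longlonglongrightarrow> indicator C x" for x
    proof (cases "x \<in> C")
      case True
      then show ?thesis by (simp add: h_def)
    next
      case x: False
      then have pos: "infdist x C > 0"
        using in_closed_iff_infdist_zero[OF C False, of x] infdist_nonneg[of x C] by simp
      have "h n x = 0" if "n \<ge> nat \<lceil>1 / infdist x C\<rceil>" for n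
        using that pos by (simp add: h_def nat_le_iff ceiling_le_iff field_simps)
      then have "eventually (\<lambda>n. h n x = 0) sequentially"
        by (rule eventually_sequentiallyI)
      then show ?thesis
        using x by (simp add: tendsto_eventually)
    qed
    have conv: "(\<lambda>n. LINT x|L. h n x) \<longlonglongrightarrow> measure L C" if L: "prob_space L" "sets L = sets borel" for L
    proof -
      interpret L: prob_space L by fact
      have CL: "C \<in> sets L" using C L by simp
      have "(\<lambda>n. LINT x|L. h n x) \<longlonglongrightarrow> (LINT x|L. indicator C x)"
      proof (rule integral_dominated_convergence[where w = "\<lambda>_. 1"])
        show "h n \<in> borel_measurable L" for n
          using h(1)[of n] L by (simp add: borel_measurable_continuous_onI cong: measurable_cong_sets)
      qed (use h lim CL in auto)
      then show ?thesis
        using CL sets.sets_into_space[OF CL] by (simp add: Int_absorb1)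
    qed
    have "measure M C = measure N C"
      using conv[OF M] conv[OF N] eq[OF h(1)] h(2,3) LIMSEQ_unique by simp
    then show ?thesis
      using M N by (simp add: finite_measure.emeasure_eq_measure prob_space.finite_measure)
  qed auto
qed

lemma measure_eqI_coordinate_monomials:
  fixes M N :: "(int \<Rightarrow> complex) measure"
  assumes M: "prob_space M" "sets M = sets borel" and N: "prob_space N" "sets N = sets borel"
    and K: "compact K" "AE x in M. x \<in> K" "AE x in N. x \<in> K"
    and eq: "\<And>F. F \<in> coordinate_monomials \<Longrightarrow> (LINT x|M. F x) = (LINT x|N. F x)"
  shows "M = N"
proof (rule measure_eqI_continuous_integrals[OF M N])
  fix h :: "(int \<Rightarrow> complex) \<Rightarrow> real"
  assume h: "continuous_on UNIV h"
  have poly_eq: "(LINT x|M. F x) = (LINT x|N. F x)" if "F \<in> coordinate_polynomials" for F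
    using that
  proof (induction rule: coordinate_polynomials.induct)
    case (add F G)
    then show ?case
      by (simp add: integrable_continuous_on_compact_support[OF M K(1,2)]
          integrable_continuous_on_compact_support[OF N K(1,3)] continuous_coordinate_polynomial)
  qed (simp add: eq)
  have "norm ((LINT x|M. complex_of_real (h x)) - (LINT x|N. complex_of_real (h x))) \<le> 0 + e" if e: "e > 0" for e
  proof -
    obtain F where F: "F \<in> coordinate_polynomials" "\<And>x. x \<in> K \<Longrightarrow> norm (F x - of_real (h x)) < e / 2"
      using coordinate_polynomials_dense[OF K(1) continuous_on_subset[OF h], of "e / 2"] e by auto
    have "norm ((LINT x|L. F x) - (LINT x|L. complex_of_real (h x))) \<le> e / 2"
      if "prob_space L" "sets L = sets borel" "AE x in L. x \<in> K" for L
      using that K(1) F h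
      by (intro integral_close_on_support[of L K])
        (auto intro!: continuous_coordinate_polynomial continuous_intros less_imp_le)
    from this[OF M K(2)] this[OF N K(3)] poly_eq[OF F(1)] show ?thesis
      using norm_triangle_ineq4[of "(LINT x|N. F x) - (LINT x|N. complex_of_real (h x))"
          "(LINT x|M. F x) - (LINT x|M. complex_of_real (h x))"] by simp
  qed
  then have "norm ((LINT x|M. complex_of_real (h x)) - (LINT x|N. complex_of_real (h x))) \<le> 0"
    by (rule field_le_epsilon)
  then show "(LINT x|M. h x) = (LINT x|N. h x)"
    by simp
qed

section \<open>A criterion for unique ergodicity\<close>

lemma orbit_mem_orbit_closure:
  assumes "f \<in> sup_ball B"
  shows "(\<lambda>m. f (m + n)) \<in> orbit_closure f"
  unfolding orbit_closure_eq[OF assms] by (rule subsetD[OF closure_subset]) blast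

lemma compact_orbit_closure: "f \<in> sup_ball B \<Longrightarrow> compact (orbit_closure f)"
  using orbit_closure_eq[of f B] compact_sup_ball[of B]
  by (metis closed_closure compact_Int_closed inf.absorb_iff2 inf_commute)

lemma shift_borel_measurable [measurable]: "shift \<in> borel_measurable borel"
  by (intro borel_measurable_continuous_onI continuous_shift)

text \<open>
  The uniqueness half. An invariant measure gives \<open>F\<close> and its ergodic averages the same integral,
  and these averages are uniformly close to \<open>c\<close> on the orbit, hence on its closure.
\<close>
lemma invariant_integral_eq_uniform_mean:
  assumes f: "f \<in> sup_ball B"
    and M: "prob_space M" "sets M = sets borel" and supp: "AE x in M. x \<in> orbit_closure f"
    and inv: "distr M borel shift = M"
    and F: "continuous_on UNIV F" and mean: "has_uniform_mean (\<lambda>n. F (\<lambda>m. f (m + n))) c"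
  shows "(LINT x|M. F x) = c"
proof -
  interpret prob_space M by (rule M)
  let ?X = "orbit_closure f"
  have X: "compact ?X"
    using f by (rule compact_orbit_closure)
  have contn: "continuous_on UNIV (\<lambda>x. F ((shift ^^ n) x))" for n
  proof -
    have "continuous_on UNIV (shift ^^ n)"
      unfolding funpow_shift[abs_def]
      by (intro continuous_on_coordinatewise_then_product continuous_coordinate)
    then show ?thesis
      by (rule continuous_on_compose2[OF F]) auto
  qed
  have int: "integrable M (\<lambda>x. F ((shift ^^ n) x))" for n
    by (rule integrable_continuous_on_compact_support[OF M X supp contn])
  have step: "(LINT x|M. F ((shift ^^ n) x)) = (LINT x|M. F x)" for n
  proof (induction n)
    case (Suc n)
    have "(LINT x|M. F ((shift ^^ n) x)) = (LINT x|distr M borel shift. F ((shift ^^ n) x))"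
      by (simp add: inv)
    also have "\<dots> = (LINT x|M. F ((shift ^^ n) (shift x)))"
    proof (rule integral_distr)
      show "shift \<in> measurable M borel"
        using M by (simp cong: measurable_cong_sets)
    qed (intro borel_measurable_continuous_onI contn)
    finally show ?case
      using Suc by (simp add: funpow_swap1)
  qed simp
  have "norm ((LINT x|M. F x) - c) \<le> 0 + e" if e: "e > 0" for e
  proof -
    obtain N0 where N0: "\<And>N a. N \<ge> N0 \<Longrightarrow>
        norm ((\<Sum>n<N. F (\<lambda>m. f (m + (a + int n)))) / of_nat N - c) < e"
      using mean e unfolding has_uniform_mean_def uniform_limit_sequentially_iff dist_norm by blast
    \<comment> \<open>One window length is enough, and it must be positive.\<close>
    define N where "N = Suc N0"
    define A where "A = (\<lambda>x. (\<Sum>n<N. F ((shift ^^ n) x)) / of_nat N)"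
    have contA: "continuous_on UNIV A"
      unfolding A_def N_def by (intro continuous_intros contn) (simp del: of_nat_Suc)
    have "norm (A x - c) \<le> e" if "x \<in> ?X" for x
    proof -
      let ?O = "range (\<lambda>n m. f (m + n))"
      have "x \<in> closure ?O"
        using that orbit_closure_eq(1)[OF f] by simp
      moreover have "A ` closure ?O \<subseteq> cball c e"
      proof (rule image_closure_subset[OF continuous_on_subset[OF contA] closed_cball])
        show "A ` ?O \<subseteq> cball c e"
          using N0[of N] by (force simp: A_def N_def funpow_shift dist_norm norm_minus_commute algebra_simps
              intro: less_imp_le)
      qed simp
      ultimately have "A x \<in> cball c e"
        by blast
      then show ?thesis
        by (simp add: dist_norm norm_minus_commute)
    qed
    then have "norm ((LINT x|M. A x) - (LINT x|M. c)) \<le> e"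
      by (intro integral_close_on_support[OF M X supp contA]) auto
    moreover have "(LINT x|M. A x) = (LINT x|M. F x)"
      unfolding A_def by (simp add: int step) (simp add: N_def)
    ultimately show ?thesis
      by (simp add: prob_space)
  qed
  then have "norm ((LINT x|M. F x) - c) \<le> 0"
    by (rule field_le_epsilon)
  then show ?thesis by simp
qed

text \<open>
  If integration against \<open>M\<close> is averaging along the orbit of \<open>f\<close> for monomials, then by linearity
  it is so for coordinate polynomials. The distance to the orbit closure vanishes along the orbit;
  a coordinate polynomial close to it has small averages, hence a small integral. So the distance
  has integral \<open>0\<close> and vanishes almost everywhere.
\<close>
lemma orbit_mean_measure_on_orbit_closure:
  assumes f: "f \<in> sup_ball B"
    and M: "prob_space M" "sets M = sets borel" and supp: "AE x in M. x \<in> sup_ball B"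
    and mean: "\<And>F. F \<in> coordinate_monomials \<Longrightarrow>
                 has_uniform_mean (\<lambda>n. F (\<lambda>m. f (m + n))) (LINT x|M. F x)"
  shows "AE x in M. x \<in> orbit_closure f"
proof -
  interpret prob_space M by (rule M)
  let ?K = "sup_ball B" and ?X = "orbit_closure f"
  have X: "closed ?X" "?X \<noteq> {}"
    using compact_imp_closed[OF compact_orbit_closure[OF f]] orbit_mem_orbit_closure[OF f] by auto
  have mean_poly: "has_uniform_mean (\<lambda>n. F (\<lambda>m. f (m + n))) (LINT x|M. F x)"
    if "F \<in> coordinate_polynomials" for F
    using that
  proof (induction rule: coordinate_polynomials.induct)
    case (add F G)
    then show ?case
      by (simp add: integrable_continuous_on_compact_support[OF M compact_sup_ball supp]
          continuous_coordinate_polynomial has_uniform_mean_add)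
  qed (simp add: mean has_uniform_mean_cmult)
  let ?\<psi> = "\<lambda>x. complex_of_real (infdist x ?X)"
  have cont\<psi>: "continuous_on S ?\<psi>" for S
    by (intro continuous_intros)
  have "norm (LINT x|M. ?\<psi> x) \<le> 0 + e" if e: "e > 0" for e
  proof -
    obtain F where F: "F \<in> coordinate_polynomials" "\<And>x. x \<in> ?K \<Longrightarrow> norm (F x - ?\<psi> x) < e / 2"
    proof (rule coordinate_polynomials_dense[OF compact_sup_ball, where e = "e / 2"])
      show "continuous_on (sup_ball B) (\<lambda>x. infdist x ?X)"
        by (intro continuous_intros)
    qed (use e in auto)
    have contF: "continuous_on UNIV F"
      by (rule continuous_coordinate_polynomial[OF F(1)])
    have small: "norm (F (\<lambda>m. f (m + n))) \<le> e / 2" for n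
      using F(2)[of "\<lambda>m. f (m + n)"] orbit_mem_orbit_closure[OF f, of n] orbit_closure_eq(2)[OF f]
      by (force intro: less_imp_le)
    have "(\<lambda>N. (\<Sum>n<N. F (\<lambda>m. f (m + (0 + int n)))) / of_nat N) \<longlonglongrightarrow> (LINT x|M. F x)"
      using tendsto_uniform_limitI[OF mean_poly[OF F(1), unfolded has_uniform_mean_def], of 0] by simp
    moreover have "norm ((\<Sum>n<N. F (\<lambda>m. f (m + (0 + int n)))) / of_nat N) \<le> e / 2" for N
    proof (cases "N = 0")
      case False
      have "norm (\<Sum>n<N. F (\<lambda>m. f (m + (0 + int n)))) \<le> (\<Sum>n<N. e / 2)"
        by (intro order_trans[OF norm_sum] sum_mono small)
      then show ?thesis
        using False by (simp add: norm_divide field_simps)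
    qed (use e in auto)
    ultimately have "norm (LINT x|M. F x) \<le> e / 2"
      by (intro Lim_bounded[OF tendsto_norm]) auto
    moreover have "norm ((LINT x|M. F x) - (LINT x|M. ?\<psi> x)) \<le> e / 2"
      by (rule integral_close_on_support[OF M compact_sup_ball supp contF cont\<psi>]) (rule less_imp_le[OF F(2)])
    ultimately show ?thesis
      using norm_triangle_ineq4[of "LINT x|M. F x" "(LINT x|M. F x) - (LINT x|M. ?\<psi> x)"] by simp
  qed
  then have "norm (LINT x|M. ?\<psi> x) \<le> 0"
    by (rule field_le_epsilon)
  then have "(LINT x|M. infdist x ?X) = 0"
    by simp
  moreover have "integrable M (\<lambda>x. infdist x ?X)"
    by (rule integrable_continuous_on_compact_support[OF M compact_sup_ball supp]) (intro continuous_intros)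
  ultimately have "AE x in M. infdist x ?X = 0"
    by (subst (asm) integral_nonneg_eq_0_iff_AE) (auto simp: infdist_nonneg)
  then show ?thesis
    using in_closed_iff_infdist_zero[OF X] by simp
qed

text \<open>
  For regularity, finite Borel measures on a Polish space are regular, and the
  relatively open subsets of \<open>X\<close> are the traces of open sets, which have the same measure because
  the complement of \<open>X\<close> is null.
\<close>
lemma invariant_probability_on_restrict_space:
  fixes M :: "'a::polish_space measure"
  assumes M: "prob_space M" "sets M = sets borel" and X: "closed X" and supp: "AE x in M. x \<in> X"
    and T: "T \<in> borel_measurable borel" and inv: "distr M borel T = M"
  shows "invariant_probability_on X T (restrict_space M X)"
proof -
  interpret prob_space M by (rule M)
  let ?N = "restrict_space M X"
  have spM: "space M = UNIV"
    using sets_eq_imp_space_eq[OF M(2)] by simp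
  have XM: "X \<in> sets M"
    using X M by simp
  have emN: "emeasure ?N A = emeasure M A" if "A \<subseteq> X" for A
    using that XM by (intro emeasure_restrict_space) auto
  have setsN: "A \<in> sets ?N \<longleftrightarrow> A \<subseteq> X \<and> A \<in> sets borel" for A
    using XM M(2) by (simp add: sets_restrict_space_iff)
  have Xint: "emeasure M (A \<inter> X) = emeasure M A" if "A \<in> sets borel" for A
    using that supp XM M(2) by (intro emeasure_eq_AE) auto
  have "sets ?N = sets (restrict_space borel X)"
    using M(2) by (simp add: sets_restrict_space)
  moreover have "emeasure ?N B = (SUP K\<in>{K. K \<subseteq> B \<and> compact K}. emeasure ?N K)" if "B \<in> sets ?N" for B
  proof -
    have B: "B \<subseteq> X" "B \<in> sets borel"
      using that setsN by auto
    have "emeasure M B = (SUP K\<in>{K. K \<subseteq> B \<and> compact K}. emeasure M K)"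
      using B by (intro inner_regular M) auto
    then show ?thesis
      using B emN by (auto intro!: SUP_cong simp: emN)
  qed
  moreover have "emeasure ?N B = (INF U\<in>{U. B \<subseteq> U \<and> openin (top_of_set X) U}. emeasure ?N U)" if "B \<in> sets ?N" for B
  proof -
    have B: "B \<subseteq> X" "B \<in> sets borel"
      using that setsN by auto
    have "emeasure M B = (INF U\<in>{U. B \<subseteq> U \<and> open U}. emeasure M U)"
      using B by (intro outer_regular M) auto
    also have "\<dots> = (INF U\<in>{U. B \<subseteq> U \<and> open U}. emeasure ?N (X \<inter> U))"
      using Xint emN by (auto intro!: INF_cong simp: Int_commute)
    also have "\<dots> = (INF U\<in>(\<lambda>U. X \<inter> U) ` {U. B \<subseteq> U \<and> open U}. emeasure ?N U)"
      by (simp add: image_comp)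
    also have "(\<lambda>U. X \<inter> U) ` {U. B \<subseteq> U \<and> open U} = {U. B \<subseteq> U \<and> openin (top_of_set X) U}"
      using B by (auto simp: openin_open)
    finally show ?thesis
      using B emN by simp
  qed
  moreover have "prob_space ?N"
    using emN[OF order_refl] Xint[of UNIV] emeasure_space_1 spM XM
    by (intro prob_spaceI) (simp add: space_restrict_space)
  moreover have "emeasure ?N (T -` B \<inter> X) = emeasure ?N B" if "B \<in> sets ?N" for B
  proof -
    have B: "B \<subseteq> X" "B \<in> sets borel"
      using that setsN by auto
    have T': "T \<in> measurable M borel"
      using T M by (simp cong: measurable_cong_sets)
    have "emeasure M B = emeasure (distr M borel T) B"
      by (simp add: inv)
    also have "\<dots> = emeasure M (T -` B)"
      using B T' spM by (simp add: emeasure_distr)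
    also have "\<dots> = emeasure M (T -` B \<inter> X)"
      using B T by (intro Xint[symmetric]) (metis (no_types) measurable_sets_borel)
    finally show ?thesis
      using B emN by simp
  qed
  ultimately show ?thesis
    unfolding invariant_probability_on_def regular_borel_measure_on_def by blast
qed

text \<open>
  A measure on the subspace \<open>X\<close> is viewed as a Borel measure on the whole space, so that two
  competitors can be compared by integrals over the whole space. The last clause recovers the
  original measure.
\<close>
lemma invariant_probability_on_extend:
  assumes M: "invariant_probability_on X T M" and X: "closed X"
    and T: "T \<in> borel_measurable borel" and TX: "T ` X \<subseteq> X"
  defines "E \<equiv> distr M borel (\<lambda>x. x)"
  shows "prob_space E" "sets E = sets borel" "AE x in E. x \<in> X" "distr E borel T = E"
    "\<And>B. B \<in> sets M \<Longrightarrow> emeasure E B = emeasure M B"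
proof -
  have setsM: "sets M = sets (restrict_space borel X)" and "prob_space M"
    and inv: "\<And>B. B \<in> sets M \<Longrightarrow> emeasure M (T -` B \<inter> X) = emeasure M B"
    using M by (auto simp: invariant_probability_on_def regular_borel_measure_on_def)
  interpret prob_space M by fact
  have spM: "space M = X"
    using sets_eq_imp_space_eq[OF setsM] by (simp add: space_restrict_space)
  have id: "(\<lambda>x. x) \<in> measurable M borel"
    by (subst measurable_cong_sets[OF setsM refl]) (simp add: measurable_restrict_space1)
  have memM: "B \<in> sets M \<longleftrightarrow> B \<subseteq> X \<and> B \<in> sets borel" for B
    using X by (simp add: setsM sets_restrict_space_iff)
  show "prob_space E"
    unfolding E_def using id by (rule prob_space_distr)
  show sE: "sets E = sets borel"
    by (simp add: E_def)
  have emE: "emeasure E B = emeasure M (B \<inter> X)" if "B \<in> sets borel" for B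
    using that id spM by (simp add: E_def emeasure_distr)
  show "AE x in E. x \<in> X"
    unfolding E_def using id X spM by (subst AE_distr_iff) (auto simp: )
  show "emeasure E B = emeasure M B" if "B \<in> sets M" for B
    using that emE memM by (simp add: Int_absorb2)
  show "distr E borel T = E"
  proof (rule measure_eqI)
    fix B assume "B \<in> sets (distr E borel T)"
    then have B: "B \<in> sets borel"
      by simp
    have "emeasure (distr E borel T) B = emeasure E (T -` B)"
      using B T sets_eq_imp_space_eq[OF sE] sE by (simp add: emeasure_distr cong: measurable_cong_sets)
    also have "\<dots> = emeasure M (T -` B \<inter> X)"
      using B T by (intro emE) (metis (no_types) measurable_sets_borel)
    also have "T -` B \<inter> X = T -` (B \<inter> X) \<inter> X"
      using TX by auto
    also have "emeasure M \<dots> = emeasure M (B \<inter> X)"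
      using B X by (intro inv) (simp add: memM)
    also have "\<dots> = emeasure E B"
      using B by (simp add: emE)
    finally show "emeasure (distr E borel T) B = emeasure E B" .
  qed (simp add: sE)
qed

text \<open>
  The limit of the averages along an orbit does not notice a shift, so \<open>M\<close> and its image under the
  shift give all monomials the same integrals; therefore \<open>M\<close> is invariant. Any other invariant
  measure on the orbit closure also integrates monomials to these limits.
\<close>
theorem uniquely_ergodic_if_uniform_means:
  assumes f: "f \<in> sup_ball B"
    and M: "prob_space M" "sets M = sets borel" and supp: "AE x in M. x \<in> sup_ball B"
    and mean: "\<And>F. F \<in> coordinate_monomials \<Longrightarrow>
                 has_uniform_mean (\<lambda>n. F (\<lambda>m. f (m + n))) (LINT x|M. F x)"
  shows "uniquely_ergodic f"
proof -
  let ?X = "orbit_closure f"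
  have X: "compact ?X" "closed ?X"
    using compact_orbit_closure[OF f] by (auto intro: compact_imp_closed)
  have suppX: "AE x in M. x \<in> ?X"
    by (rule orbit_mean_measure_on_orbit_closure[OF assms])
  have shiftM: "shift \<in> measurable M borel"
    using M by (simp cong: measurable_cong_sets)
  have inv: "distr M borel shift = M"
  proof (rule measure_eqI_coordinate_monomials)
    show "prob_space (distr M borel shift)"
      by (rule prob_space.prob_space_distr[OF M(1) shiftM])
    show "AE x in distr M borel shift. x \<in> sup_ball B"
      using supp compact_imp_closed[OF compact_sup_ball, of B] shiftM
      by (subst AE_distr_iff) (auto simp: sup_ball_def shift_def)
    fix F assume F: "F \<in> coordinate_monomials"
    have cF: "continuous_on UNIV F"
      using F by (rule continuous_coordinate_monomial)
    have "bounded (F ` sup_ball B)"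
      using cF by (intro compact_imp_bounded compact_continuous_image compact_sup_ball)
        (auto intro: continuous_on_subset)
    then obtain b where "\<And>x. x \<in> sup_ball B \<Longrightarrow> norm (F x) \<le> b"
      by (auto simp: bounded_iff)
    then have b: "norm (F (\<lambda>m. f (m + n))) \<le> b" for n
      using f by (auto simp: sup_ball_def)
    have "(LINT x|distr M borel shift. F x) = (LINT x|M. F (shift x))"
      using cF by (intro integral_distr shiftM borel_measurable_continuous_onI)
    also have "\<dots> = (LINT x|M. F x)"
    proof (rule has_uniform_mean_unique)
      show "has_uniform_mean (\<lambda>n. F (shift (\<lambda>m. f (m + n)))) (LINT x|M. F (shift x))"
        by (rule mean[OF coordinate_monomial_shift[OF F]])
      show "has_uniform_mean (\<lambda>n. F (shift (\<lambda>m. f (m + n)))) (LINT x|M. F x)"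
        using has_uniform_mean_shift[OF mean[OF F] b] by (simp add: shift_def algebra_simps)
    qed
    finally show "(LINT x|distr M borel shift. F x) = (LINT x|M. F x)" .
  qed (use M supp compact_sup_ball in auto)
  show ?thesis
    unfolding uniquely_ergodic_def uniquely_ergodic_system_def
  proof (intro conjI ex1I)
    show "f \<in> l_infty"
      using f sup_ball_subset_l_infty by blast
    show "invariant_probability_on ?X shift (restrict_space M ?X)"
      by (intro invariant_probability_on_restrict_space M X suppX inv shift_borel_measurable)
    fix N assume N: "invariant_probability_on ?X shift N"
    define E where "E = distr N borel (\<lambda>x. x)"
    note E = invariant_probability_on_extend[OF N X(2) shift_borel_measurable
        shift_orbit_closure_subset[OF f], folded E_def]
    have "E = M"
    proof (rule measure_eqI_coordinate_monomials[OF E(1,2) M X(1) E(3) suppX])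
      fix F assume "F \<in> coordinate_monomials"
      then show "(LINT x|E. F x) = (LINT x|M. F x)"
        by (intro invariant_integral_eq_uniform_mean[OF f E(1-4)] mean continuous_coordinate_monomial)
    qed
    have setsN: "sets N = sets (restrict_space borel ?X)"
      using N by (simp add: invariant_probability_on_def regular_borel_measure_on_def)
    show "N = restrict_space M ?X"
    proof (rule measure_eqI)
      show "sets N = sets (restrict_space M ?X)"
        using setsN M(2) by (simp add: sets_restrict_space)
      fix A assume A: "A \<in> sets N"
      then have "A \<subseteq> ?X"
        using X by (simp add: setsN sets_restrict_space_iff)
      then show "emeasure N A = emeasure (restrict_space M ?X) A"
        using E(5)[OF A] \<open>E = M\<close> X M(2) by (simp add: emeasure_restrict_space)
    qed
  qed
qed

text \<open>
  The orbit closure is a point, and the point mass there gives every monomial its only value.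
\<close>
lemma uniquely_ergodic_const: "uniquely_ergodic (\<lambda>_. c)"
proof (rule uniquely_ergodic_if_uniform_means)
  let ?M = "return borel (\<lambda>_ :: int. c)"
  show "(\<lambda>_. c) \<in> sup_ball (norm c)"
    by (simp add: sup_ball_def)
  show "prob_space ?M"
    by (rule prob_space_return) simp
  show "AE x in ?M. x \<in> sup_ball (norm c)"
    using compact_imp_closed[OF compact_sup_ball, of "norm c"]
    by (subst AE_return) (auto simp: sup_ball_def)
  fix F assume "F \<in> coordinate_monomials"
  then have "F \<in> borel_measurable borel"
    by (intro borel_measurable_continuous_onI continuous_coordinate_monomial)
  then have "(LINT x|?M. F x) = F (\<lambda>_. c)"
    by (intro integral_return) auto
  then show "has_uniform_mean (\<lambda>n. F (\<lambda>m. c)) (LINT x|?M. F x)"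
    by (simp add: has_uniform_mean_const)
qed simp

section \<open>The Haar measure of the torus and polynomial phases\<close>

definition uniform_unit_interval :: "real measure" where
  "uniform_unit_interval = restrict_space lborel {0..1}"

lemma prob_space_uniform_unit_interval: "prob_space uniform_unit_interval"
  unfolding uniform_unit_interval_def
  by (rule prob_space_restrict_space) auto

text \<open>
  Orthogonality of the characters of the circle.
\<close>
lemma integral_uniform_cis:
  "(LINT t|uniform_unit_interval. cis (2 * pi * t) powi s) = (if s = 0 then 1 else 0)"
proof (cases "s = 0")
  case True
  then show ?thesis
    using prob_space.prob_space[OF prob_space_uniform_unit_interval] by simp
next
  case False
  define w where "w = 2 * pi * real_of_int s"
  have w: "w \<noteq> 0"
    using False by (simp add: w_def)
  have pw: "cis (2 * pi * t) powi s = cis (w * t)" for t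
    by (simp add: cis_power_int w_def mult_ac)
  have "(LINT t|uniform_unit_interval. cis (w * t)) = (LINT t|lborel. indicator {0..1} t *\<^sub>R cis (w * t))"
    unfolding uniform_unit_interval_def by (rule integral_restrict_space) simp
  also have "\<dots> = cis (w * 1) / (\<i> * w) - cis (w * 0) / (\<i> * w)"
  proof (rule integral_FTC_atLeastAtMost)
    fix t :: real
    have "((\<lambda>t. exp (\<i> * of_real w * of_real t) / (\<i> * of_real w)) has_vector_derivative
             (exp (\<i> * of_real w * of_real t))) (at t within {0..1})"
    proof (rule has_vector_derivative_real_field)
      show "((\<lambda>u. exp (\<i> * of_real w * u) / (\<i> * of_real w)) has_field_derivative
               exp (\<i> * of_real w * of_real t)) (at (of_real t))"
        using w by (auto intro!: derivative_eq_intros)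
    qed
    then show "((\<lambda>t. cis (w * t) / (\<i> * of_real w)) has_vector_derivative cis (w * t)) (at t within {0..1})"
      by (simp add: cis_conv_exp mult_ac)
  next
    show "continuous_on {0..1} (\<lambda>t. cis (w * t))"
      by (intro continuous_intros)
  qed simp
  also have "cis (w * 1) = 1"
    by (simp add: w_def)
  finally show ?thesis
    using False by (simp add: pw)
qed

lemma power_int_sum:
  fixes z :: "'a::field"
  assumes "z \<noteq> 0"
  shows "z powi (\<Sum>i\<in>A. g i) = (\<Prod>i\<in>A. z powi g i)"
  using assms by (induction A rule: infinite_finite_induct) (auto simp: power_int_add)

text \<open>
  For \<open>y i = cis (2 * pi * c i)\<close> this is \<open>cis (2 * pi * (\<Sum>i\<le>k. c i * n ^ i))\<close>. As \<open>n\<close> is an integer,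
  only the classes of the coefficients \<open>c i\<close> modulo \<open>1\<close> matter, and these form a torus.
\<close>
definition polynomial_phase :: "nat \<Rightarrow> (nat \<Rightarrow> complex) \<Rightarrow> int \<Rightarrow> complex" where
  "polynomial_phase k y n = (\<Prod>i\<le>k. y i powi (n ^ i))"

lemma norm_polynomial_phase:
  "(\<And>i. i \<le> k \<Longrightarrow> norm (y i) = 1) \<Longrightarrow> norm (polynomial_phase k y n) = 1"
  unfolding polynomial_phase_def by (simp add: prod_norm[symmetric] norm_power_int)

text \<open>
  In the parameters \<open>y\<close>, monomials are characters of the torus. The exponents \<open>s\<close> determine both the
  integral of the monomial over the torus and its values along the orbit.
\<close>
lemma monomial_polynomial_phase:
  assumes "F \<in> coordinate_monomials"
  shows "\<exists>s. \<forall>y. (\<forall>i\<le>k. norm (y i) = 1) \<longrightarrow> F (polynomial_phase k y) = (\<Prod>i\<le>k. y i powi s i)"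
  using assms
proof (induction rule: coordinate_monomials.induct)
  case one
  show ?case
    by (rule exI[of _ "\<lambda>_. 0"]) simp
next
  case (coord F j)
  then obtain s where s: "\<And>y. (\<forall>i\<le>k. norm (y i) = 1) \<Longrightarrow> F (polynomial_phase k y) = (\<Prod>i\<le>k. y i powi s i)"
    by blast
  have "polynomial_phase k y j * F (polynomial_phase k y) = (\<Prod>i\<le>k. y i powi (j ^ i + s i))"
    if y: "\<forall>i\<le>k. norm (y i) = 1" for y
  proof -
    have "y i powi (j ^ i) * y i powi s i = y i powi (j ^ i + s i)" if "i \<le> k" for i
      by (rule power_int_add[symmetric]) (use y that in force)
    then show ?thesis
      unfolding s[OF y] polynomial_phase_def prod.distrib[symmetric] by (intro prod.cong) auto
  qed
  then show ?case
    by (intro exI[of _ "\<lambda>i. j ^ i + s i"]) simp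
next
  case (conj_coord F j)
  then obtain s where s: "\<And>y. (\<forall>i\<le>k. norm (y i) = 1) \<Longrightarrow> F (polynomial_phase k y) = (\<Prod>i\<le>k. y i powi s i)"
    by blast
  have "cnj (polynomial_phase k y j) * F (polynomial_phase k y) = (\<Prod>i\<le>k. y i powi (- (j ^ i) + s i))"
    if y: "\<forall>i\<le>k. norm (y i) = 1" for y
  proof -
    have "cnj (y i powi (j ^ i)) * y i powi s i = y i powi (- (j ^ i) + s i)" if "i \<le> k" for i
    proof -
      have 1: "norm (y i) = 1" "y i \<noteq> 0"
        using y that by force+
      show ?thesis
        unfolding cnj_power_int_unit[OF 1(1)] by (rule power_int_add[symmetric]) (use 1(2) in simp)
    qed
    then show ?thesis
      unfolding s[OF y] polynomial_phase_def cnj_prod prod.distrib[symmetric] by (intro prod.cong) auto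
  qed
  then show ?case
    by (intro exI[of _ "\<lambda>i. - (j ^ i) + s i"]) simp
qed

text \<open>
  The binomial expansion exhibits the translates of \<open>f\<close> as polynomial phases with \<open>y k = z\<close> and
  \<open>y i = z powi ((k choose i) * n ^ (k - i))\<close>. A monomial with exponents \<open>s\<close> therefore takes the value
  \<open>z powi poly p n\<close> at the \<open>n\<close>-th translate, where \<open>p\<close> has the coefficients \<open>(k choose i) * s i\<close> in
  degree \<open>k - i\<close>. The polynomial \<open>p\<close> is constant precisely when all \<open>s i\<close> with \<open>i < k\<close> vanish, which
  is precisely when the character of the torus is constant. In that case both the mean and the
  integral are \<open>z powi s k\<close>, and otherwise both are \<open>0\<close>.
\<close>
lemma uniquely_ergodic_power_phase:
  assumes z: "irrational_circle z"
  shows "uniquely_ergodic (\<lambda>n. z powi (n ^ k))"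
proof -
  let ?U = "PiM {..<k} (\<lambda>_. uniform_unit_interval)"
  let ?y = "\<lambda>\<theta> i. if i < k then cis (2 * pi * \<theta> i) else z"
  let ?\<Phi> = "\<lambda>\<theta>. polynomial_phase k (?y \<theta>)"
  have z0: "z \<noteq> 0"
    using z by (rule irrational_circle_nonzero)
  have unit: "norm (?y \<theta> i) = 1" for \<theta> :: "nat \<Rightarrow> real" and i
    using z by (simp add: irrational_circle_def)
  interpret U: product_prob_space "\<lambda>_. uniform_unit_interval" "{..<k}"
    by (intro product_prob_spaceI prob_space_uniform_unit_interval)
  have PU: "prob_space ?U"
    by (intro prob_space_PiM prob_space_uniform_unit_interval)
  have cis_meas [measurable]: "(\<lambda>t. cis (2 * pi * t)) \<in> borel_measurable uniform_unit_interval"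
    unfolding uniform_unit_interval_def
    by (intro measurable_restrict_space1) (auto intro!: borel_measurable_continuous_onI continuous_intros)
  have pow_meas: "(\<lambda>t. cis (2 * pi * t) powi s) \<in> borel_measurable uniform_unit_interval" for s
    by (simp add: power_int_def)
  have \<Phi>: "?\<Phi> \<in> measurable ?U borel"
  proof (rule measurable_coordinatewise_then_product)
    fix n
    have "(\<lambda>\<theta>. ?y \<theta> i powi (n ^ i)) \<in> borel_measurable ?U" for i
    proof (cases "i < k")
      case True
      have "(\<lambda>\<theta>. cis (2 * pi * \<theta> i) powi (n ^ i)) \<in> borel_measurable ?U"
        by (rule measurable_compose[where g = "\<lambda>t. cis (2 * pi * t) powi (n ^ i)"])
          (rule measurable_component_singleton, simp add: True, rule pow_meas)
      then show ?thesis
        using True by simp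
    qed simp
    then show "(\<lambda>\<theta>. ?\<Phi> \<theta> n) \<in> borel_measurable ?U"
      unfolding polynomial_phase_def by (rule borel_measurable_prod)
  qed
  define M where "M = distr ?U borel ?\<Phi>"
  show ?thesis
  proof (rule uniquely_ergodic_if_uniform_means)
    show "(\<lambda>n. z powi (n ^ k)) \<in> sup_ball 1"
      by (simp add: sup_ball_def norm_irrational_powi z)
    show "prob_space M"
      unfolding M_def by (rule prob_space.prob_space_distr[OF PU \<Phi>])
    show "AE x in M. x \<in> sup_ball 1"
      unfolding M_def using compact_imp_closed[OF compact_sup_ball, of 1]
      by (subst AE_distr_iff[OF \<Phi>]) (auto simp: sup_ball_def norm_polynomial_phase unit)
    fix F assume F: "F \<in> coordinate_monomials"
    then obtain s where s: "\<And>y. (\<forall>i\<le>k. norm (y i) = 1) \<Longrightarrow> F (polynomial_phase k y) = (\<Prod>i\<le>k. y i powi s i)"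
      using monomial_polynomial_phase[of F k] by blast
    have "(LINT x|M. F x) = (LINT \<theta>|?U. F (?\<Phi> \<theta>))"
      unfolding M_def using F
      by (intro integral_distr \<Phi> borel_measurable_continuous_onI continuous_coordinate_monomial)
    also have "(\<lambda>\<theta>. F (?\<Phi> \<theta>)) = (\<lambda>\<theta>. (\<Prod>i<k. cis (2 * pi * \<theta> i) powi s i) * z powi s k)"
    proof
      fix \<theta> :: "nat \<Rightarrow> real"
      have "F (?\<Phi> \<theta>) = (\<Prod>i\<le>k. ?y \<theta> i powi s i)"
        by (rule s) (intro allI impI unit)
      also have "\<dots> = (\<Prod>i<k. cis (2 * pi * \<theta> i) powi s i) * z powi s k"
        unfolding lessThan_Suc_atMost[symmetric] by simp
      finally show "F (?\<Phi> \<theta>) = (\<Prod>i<k. cis (2 * pi * \<theta> i) powi s i) * z powi s k" .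
    qed
    also have "(LINT \<theta>|?U. (\<Prod>i<k. cis (2 * pi * \<theta> i) powi s i) * z powi s k)
                 = (\<Prod>i<k. LINT t|uniform_unit_interval. cis (2 * pi * t) powi s i) * z powi s k"
    proof -
      have "integrable uniform_unit_interval (\<lambda>t. cis (2 * pi * t) powi s i)" for i
        by (intro finite_measure.integrable_const_bound[where B = 1] prob_space.finite_measure
            prob_space_uniform_unit_interval pow_meas) (simp add: norm_power_int)
      then show ?thesis
        using U.product_integral_prod[of "{..<k}" "\<lambda>i t. cis (2 * pi * t) powi s i"] by simp
    qed
    finally have int: "(LINT x|M. F x) = (if \<forall>i<k. s i = 0 then z powi s k else 0)"
      by (auto simp: integral_uniform_cis)
    define p where "p = (\<Sum>i\<le>k. monom (int (k choose i) * s i) (k - i))"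
    have orbit: "F (\<lambda>m. z powi ((m + n) ^ k)) = z powi poly p n" for n
    proof -
      let ?w = "\<lambda>i. z powi (int (k choose i) * n ^ (k - i))"
      have "z powi ((m + n) ^ k) = polynomial_phase k ?w m" for m
        unfolding polynomial_phase_def binomial_ring power_int_sum[OF z0]
        by (intro prod.cong refl) (simp add: power_int_mult[symmetric] mult_ac)
      then have "F (\<lambda>m. z powi ((m + n) ^ k)) = (\<Prod>i\<le>k. ?w i powi s i)"
        by (simp add: s norm_irrational_powi z)
      also have "\<dots> = z powi poly p n"
        unfolding p_def poly_sum power_int_sum[OF z0]
        by (intro prod.cong refl) (simp add: poly_monom power_int_mult[symmetric] mult_ac)
      finally show ?thesis .
    qed
    have "has_uniform_mean (\<lambda>n. z powi poly p n) (LINT x|M. F x)"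
    proof (cases "\<forall>i<k. s i = 0")
      case True
      have "p = (\<Sum>i\<in>{k}. monom (int (k choose i) * s i) (k - i))"
        unfolding p_def using True by (intro sum.mono_neutral_right) (auto simp: le_less)
      then show ?thesis
        using True int by (simp add: poly_monom has_uniform_mean_const)
    next
      case False
      then obtain i where i: "i < k" "s i \<noteq> 0"
        by blast
      have "coeff p (k - i) = (\<Sum>j\<in>{i}. coeff (monom (int (k choose j) * s j) (k - j)) (k - i))"
        unfolding p_def coeff_sum using i by (intro sum.mono_neutral_right) auto
      then have "coeff p (k - i) \<noteq> 0"
        using i by simp
      then have "k - i \<le> degree p"
        by (rule le_degree)
      then obtain d where "degree p = Suc d"
        using i by (cases "degree p") auto
      then show ?thesis
        using False int Weyl_uniform_mean[OF z] by auto
    qed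
    then show "has_uniform_mean (\<lambda>n. F (\<lambda>m. z powi ((m + n) ^ k))) (LINT x|M. F x)"
      by (simp add: orbit)
  qed (simp add: M_def)
qed

lemma uniquely_ergodic_irrational_power:
  assumes "irrational_circle z"
  shows "uniquely_ergodic (\<lambda>n. z powi (m * n ^ k))"
proof (cases "m = 0")
  case True
  then show ?thesis
    by (simp add: uniquely_ergodic_const)
next
  case False
  then show ?thesis
    using uniquely_ergodic_power_phase[OF irrational_circle_powi[OF assms False], of k]
    by (simp add: power_int_mult)
qed

section \<open>Characters of monothetic groups\<close>

lemma character_int_mult:
  assumes "is_character \<phi>"
  shows "\<phi> (int_mult n x) = \<phi> x powi n"
proof -
  have h: "\<phi> (a + b) = \<phi> a * \<phi> b" and unit: "norm (\<phi> a) = 1" for a b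
    using assms by (auto simp: is_character_def)
  have nz: "\<phi> a \<noteq> 0" for a
    using unit[of a] by auto
  have one: "\<phi> 0 = 1"
    using h[of 0 0] nz[of 0] by simp
  have pow: "\<phi> ((((+) x) ^^ j) 0) = \<phi> x ^ j" for j
    by (induction j) (auto simp: one h)
  have "\<phi> (- a) = inverse (\<phi> a)" for a
    using h[of "- a" a] nz[of a] one by (simp add: field_simps)
  then show ?thesis
    by (simp add: int_mult_def power_int_def pow power_inverse)
qed

text \<open>
  A continuous character is determined by its value at \<open>\<gamma>\<close>, because the multiples of \<open>\<gamma>\<close> are dense.
  If that value is a root of unity, the character is a torsion element of the dual.
\<close>
lemma character_trivial_or_irrational:
  fixes \<gamma> :: "'a::{topological_group_add,t2_space}"
  assumes \<gamma>: "compact_monothetic \<gamma>" and tf: "torsion_free (dual_group :: ('a \<Rightarrow> complex) monoid)"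
    and \<phi>: "is_character \<phi>"
  shows "\<phi> \<gamma> = 1 \<or> irrational_circle (\<phi> \<gamma>)"
proof (rule disjCI)
  assume "\<not> irrational_circle (\<phi> \<gamma>)"
  then obtain n :: nat where n: "n > 0" "\<phi> \<gamma> ^ n = 1"
    using \<phi> unfolding irrational_circle_def is_character_def by blast
  have "\<phi> x ^ n = 1" for x
  proof -
    have "closed {x. \<phi> x ^ n = 1}"
      using \<phi> unfolding is_character_def by (intro closed_Collect_eq continuous_intros) auto
    moreover have "\<phi> (int_mult j \<gamma>) ^ n = 1" for j
      unfolding character_int_mult[OF \<phi>]
      using n(2) by (metis mult.commute power_int_1_left power_int_mult power_int_of_nat)
    ultimately have "closure (range (\<lambda>j. int_mult j \<gamma>)) \<subseteq> {x. \<phi> x ^ n = 1}"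
      by (intro closure_minimal) auto
    then show ?thesis
      using \<gamma> by (auto simp: compact_monothetic_def)
  qed
  moreover have "\<phi> [^]\<^bsub>dual_group\<^esub> n = (\<lambda>x. \<phi> x ^ n)"
  proof (induction n)
    case (Suc n)
    then show ?case
      by (simp add: nat_pow_Suc dual_group_def mult.commute)
  qed (simp add: dual_group_def)
  ultimately have "\<phi> [^]\<^bsub>dual_group\<^esub> n = \<one>\<^bsub>dual_group\<^esub>"
    by (simp add: dual_group_def)
  then have "\<phi> = \<one>\<^bsub>dual_group\<^esub>"
    using tf n(1) \<phi> unfolding torsion_free_def by (auto simp: dual_group_def)
  then show "\<phi> \<gamma> = 1"
    by (simp add: dual_group_def)
qed

theorem corollary5p2:
  "(\<forall>\<gamma>\<^sub>0 :: 'a::{topological_group_add,t2_space}.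
      compact_monothetic \<gamma>\<^sub>0 \<and> torsion_free (dual_group :: ('a \<Rightarrow> complex) monoid) \<longrightarrow>
      (\<forall>\<phi>\<in>carrier (dual_group :: ('a \<Rightarrow> complex) monoid). \<forall>k::nat.
         uniquely_ergodic (\<lambda>n::int. \<phi> (int_mult (n ^ k) \<gamma>\<^sub>0)))) \<and>
   (\<forall>(m::int) (k::nat) (z::complex). irrational_circle z \<longrightarrow>
      uniquely_ergodic (\<lambda>n::int. z powi (m * n ^ k)))"
proof (intro conjI allI impI ballI)
  fix \<gamma> :: 'a and \<phi> :: "'a \<Rightarrow> complex" and k :: nat
  assume G: "compact_monothetic \<gamma> \<and> torsion_free (dual_group :: ('a \<Rightarrow> complex) monoid)"
    and "\<phi> \<in> carrier dual_group"
  then have \<phi>: "is_character \<phi>"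
    by (simp add: dual_group_def)
  from G have "\<phi> \<gamma> = 1 \<or> irrational_circle (\<phi> \<gamma>)"
    using character_trivial_or_irrational[OF _ _ \<phi>] by blast
  then show "uniquely_ergodic (\<lambda>n. \<phi> (int_mult (n ^ k) \<gamma>))"
    unfolding character_int_mult[OF \<phi>]
    using uniquely_ergodic_power_phase uniquely_ergodic_const[of 1] by auto
qed (rule uniquely_ergodic_irrational_power)

end
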